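(* Let $d=2^t$ be a power of two. Let $m$ be a positive integer, and let $X = \{x_1, \dots, x_m\} \subset \mathbb{R}^{2d-2}$ be a set of $m$ points. Let $\mu_1, \dots, \mu_m$ be masses on $\mathbb{R}^d$, and suppose that there is a $c>0$ such that for every pair of hyperplanes $H_1$ and $H_2$ there is an $\ell\in [m]$ such that $|\rho_{\mu_\ell}(H_1,H_2)|\ge c$. Then there is a pair of hyperplanes $H_1$ and $H_2$ and disjoint subsets $S, T \subset [m]$ such that $\operatorname{conv}\{x_i \mid i\in S\} \cap \operatorname{conv}\{x_i \mid i \in T\}\neq \emptyset$ and \[\rho_{\mu_i}(H_1, H_2) \ge c \text{ for all } i \in S \quad\text{and}\quad \rho_{\mu_i}(H_1, H_2) \le -c \text{ for all } i \in T.\]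
   Context: A mass is a compactly supported Borel measure $\mu$ on $\mathbb{R}^d$ with $\mu(\mathbb{R}^d)=1$ that vanishes on every affine hyperplane. Hyperplanes are parametrized by points $(z,b)$ of the unit sphere $S^d\subset\mathbb{R}^d\times\mathbb{R}$, giving the ordered pair of halfspaces $H^+=\{x \mid \langle x,z\rangle\ge b\}$, $H^-=\{x \mid \langle x,z\rangle\le b\}$; this includes the degenerate cases $z=0$, corresponding to the partitions $(\mathbb{R}^d,\emptyset)$ and $(\emptyset,\mathbb{R}^d)$. For a mass $\mu$ and hyperplanes $H_1,H_2$, $\rho_\mu(H_1,H_2) = \mu(H_1^+\cap H_2^+)+\mu(H_1^-\cap H_2^-) - \mu(H_1^+\cap H_2^-) - \mu(H_1^-\cap H_2^+)$. *)

theory Defs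
  imports "HOL-Analysis.Analysis"
begin

definition measure_support :: "'a::topological_space measure \<Rightarrow> 'a set" where
  "measure_support \<mu> = {x. \<forall>U. open U \<and> x \<in> U \<longrightarrow> emeasure \<mu> U > 0}"

definition mass :: "(real ^ 'n) measure \<Rightarrow> bool" where
  "mass \<mu> \<longleftrightarrow>
     sets \<mu> = sets borel \<and>
     compact (measure_support \<mu>) \<and>
     emeasure \<mu> UNIV = 1 \<and>
     (\<forall>z b. z \<noteq> 0 \<longrightarrow> emeasure \<mu> {x. x \<bullet> z = b} = 0)"

text \<open>The unit sphere of \<open>\<real>\<^sup>d \<times> \<real>\<close>; its two points with \<open>z = 0\<close> are the degenerate hyperplanes.\<close>

definition hyperplanes :: "((real ^ 'n) \<times> real) set" where
  "hyperplanes = sphere 0 1"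

definition pos_half :: "(real ^ 'n) \<times> real \<Rightarrow> (real ^ 'n) set" where
  "pos_half H = {x. x \<bullet> fst H \<ge> snd H}"

definition neg_half :: "(real ^ 'n) \<times> real \<Rightarrow> (real ^ 'n) set" where
  "neg_half H = {x. x \<bullet> fst H \<le> snd H}"

definition rho :: "(real ^ 'n) measure \<Rightarrow> (real ^ 'n) \<times> real \<Rightarrow> (real ^ 'n) \<times> real \<Rightarrow> real" where
  "rho \<mu> H\<^sub>1 H\<^sub>2 =
     measure \<mu> (pos_half H\<^sub>1 \<inter> pos_half H\<^sub>2) + measure \<mu> (neg_half H\<^sub>1 \<inter> neg_half H\<^sub>2)
     - measure \<mu> (pos_half H\<^sub>1 \<inter> neg_half H\<^sub>2) - measure \<mu> (neg_half H\<^sub>1 \<inter> pos_half H\<^sub>2)"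

end

theory Submission
  imports Defs "HOL-Library.Z2"
begin

text \<open>
  Weighting \<open>(x\<^sub>i, 1)\<close> by the value \<open>\<rho>\<^sub>i(H\<^sub>1, H\<^sub>2)\<close>, cut off to \<open>0\<close> where its modulus is below some \<open>a < c\<close>,
  gives a continuous map to \<open>\<real>\<^bsup>2d-1\<^esup>\<close> that is odd in \<open>H\<^sub>1\<close> and in \<open>H\<^sub>2\<close>. A zero of this map is an affine
  dependence of the \<open>x\<^sub>i\<close>, hence a Radon partition with the threshold \<open>a\<close> in place of \<open>c\<close>; compactness
  allows \<open>a = c\<close>.

  The zero exists already on \<open>S\<^bsup>d-1\<^esup> \<times> S\<^bsup>d\<^esup>\<close>, because \<open>(\<alpha> + \<beta>)\<^bsup>p+q\<^esup> \<noteq> 0\<close> in \<open>H\<^sup>*(\<real>P\<^sup>p \<times> \<real>P\<^sup>q; \<int>/2)\<close>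
  if \<open>p + q choose p\<close> is odd, as it is for \<open>p = d - 1\<close>, \<open>q = d = 2\<^sup>t\<close>. This cohomological fact is
  replaced by a count on a fine cubical grid. Let \<open>Z(i, j)\<close> be the number mod 2 of flags of cells in the
  product of an \<open>i\<close>- and a \<open>j\<close>-dimensional hemisphere such that the \<open>k\<close>-th coordinate of the map changes
  sign between the \<open>k\<close>-th and the next cell of the flag, for all \<open>k < i + j\<close>. Stokes' formula turns the
  boundaries of the hemispheres into \<open>Z(i, j) = Z(i - 1, j) + Z(i, j - 1)\<close>, so \<open>Z(p, q)\<close> is
  \<open>p + q choose p\<close>. When this is odd there is a flag near which all coordinates of the map are small.
\<close>

text \<open>Otherwise sums of bits become \<open>XOR\<close>, out of reach of the ring
  lemmas.\<close>

declare add_bit_eq_xor [simp del] mult_bit_eq_and [simp del]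

lemma bit_add_self [simp]: "x + x = (0::bit)"
  by (cases x) auto

lemma bit_add_self_left [simp]: "x + (x + y) = (y::bit)"
  by (simp flip: add.assoc)

lemma sum_symmetric_bit_eq_0:
  fixes F :: "nat \<Rightarrow> nat \<Rightarrow> bit"
  assumes "\<And>k l. F k l = F l k" and "\<And>k. F k k = 0"
  shows "(\<Sum>k<m. \<Sum>l<m. F k l) = 0"
proof (induction m)
  case (Suc m)
  have "(\<Sum>k<m. F k m) = (\<Sum>l<m. F m l)"
    using assms(1) by (intro sum.cong) auto
  then show ?case
    using Suc by (simp add: sum.distrib assms(2))
qed simp

section \<open>The cubical grid\<close>

text \<open>A point \<open>x\<close> of the integer lattice stands for a cell of the grid with vertex set
  \<open>(2\<int>)\<^sup>m\<close>: the cell extends over an interval of length 2 centred at \<open>x k\<close> in the directions \<open>k\<close>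
  with \<open>x k\<close> odd. Cells are thus identified with their barycentres.\<close>

type_synonym cell = "nat \<Rightarrow> int"

text \<open>The faces of a cell extended in direction \<open>k\<close> are centred one step away.
  The dimension of a cell is its number of odd coordinates, so cochains of all degrees are treated
  at once.\<close>

definition cob_dir :: "nat \<Rightarrow> (cell \<Rightarrow> bit) \<Rightarrow> cell \<Rightarrow> bit" where
  "cob_dir k g x = (if odd (x k) then g (x(k := x k + 1)) + g (x(k := x k - 1)) else 0)"

definition cob :: "nat \<Rightarrow> (cell \<Rightarrow> bit) \<Rightarrow> cell \<Rightarrow> bit" where
  "cob m g x = (\<Sum>k<m. cob_dir k g x)"

definition neg_cell :: "cell \<Rightarrow> cell" where
  "neg_cell x = (\<lambda>k. - x k)"

lemma neg_cell_neg_cell [simp]: "neg_cell (neg_cell x) = x"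
  by (simp add: neg_cell_def)

lemma neg_cell_apply: "neg_cell x k = - x k"
  by (simp add: neg_cell_def)

lemma neg_cell_upd: "neg_cell (x(k := a)) = (neg_cell x)(k := - a)"
  by (auto simp: neg_cell_def)

lemma cob_dir_commute: "k \<noteq> l \<Longrightarrow> cob_dir k (cob_dir l g) x = cob_dir l (cob_dir k g) x"
  by (simp add: cob_dir_def fun_upd_twist add_ac)

lemma cob_dir_cob_dir_same [simp]: "cob_dir k (cob_dir k g) x = 0"
  by (simp add: cob_dir_def)

lemma cob_dir_sum: "cob_dir k (\<lambda>x. \<Sum>i\<in>I. g i x) x = (\<Sum>i\<in>I. cob_dir k (g i) x)"
  by (simp add: cob_dir_def sum.distrib)

lemma cob_dir_add: "cob_dir k (\<lambda>x. g x + g' x) x = cob_dir k g x + cob_dir k g' x"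
  by (simp add: cob_dir_def algebra_simps)

lemma cob_add: "cob m (\<lambda>x. g x + g' x) x = cob m g x + cob m g' x"
  by (simp add: cob_def cob_dir_add sum.distrib)

lemma cob_const [simp]: "cob m (\<lambda>_. a) x = 0"
  by (auto simp: cob_def cob_dir_def intro: sum.neutral)

lemma cob_sum: "cob m (\<lambda>x. \<Sum>i\<in>I. g i x) x = (\<Sum>i\<in>I. cob m (g i) x)"
  unfolding cob_def cob_dir_sum by (rule sum.swap)

lemma cob_cob [simp]: "cob m (cob m g) x = 0"
proof -
  have "cob m (cob m g) x = (\<Sum>k<m. \<Sum>l<m. cob_dir k (cob_dir l g) x)"
    by (simp add: cob_def[abs_def] cob_dir_sum)
  also have "\<dots> = 0"
    by (rule sum_symmetric_bit_eq_0) (auto intro: cob_dir_commute)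
  finally show ?thesis .
qed

lemma cob_dir_neg: "cob_dir k g (neg_cell x) = cob_dir k (\<lambda>x. g (neg_cell x)) x"
  by (simp add: cob_dir_def neg_cell_apply neg_cell_upd add.commute[where 'a=bit])

lemma cob_neg: "cob m g (neg_cell x) = cob m (\<lambda>x. g (neg_cell x)) x"
  by (simp add: cob_def cob_dir_neg)

lemma cob_eq_0: "(\<And>k. even (x k)) \<Longrightarrow> cob m g x = 0"
  by (simp add: cob_def cob_dir_def)

text \<open>Leibniz rule for the product of a cell flat in direction \<open>i\<close> with the
  vertex or edge centred at \<open>a\<close>.\<close>

lemma cob_upd:
  assumes "even (x i)" "i < m"
  shows "cob m g (x(i := a)) = cob m (\<lambda>x. g (x(i := a))) x +
    (if odd a then g (x(i := a + 1)) + g (x(i := a - 1)) else 0)"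
proof -
  have "cob_dir k g (x(i := a)) = cob_dir k (\<lambda>x. g (x(i := a))) x" if "k \<noteq> i" for k
    using that by (simp add: cob_dir_def fun_upd_twist)
  then have *: "(\<Sum>k\<in>{..<m}-{i}. cob_dir k g (x(i := a))) =
      (\<Sum>k\<in>{..<m}-{i}. cob_dir k (\<lambda>x. g (x(i := a))) x)"
    by (intro sum.cong) auto
  have "cob m g (x(i := a)) = cob_dir i g (x(i := a)) + (\<Sum>k\<in>{..<m}-{i}. cob_dir k g (x(i := a)))"
    unfolding cob_def using assms by (intro sum.remove) auto
  moreover have "cob m (\<lambda>x. g (x(i := a))) x =
      cob_dir i (\<lambda>x. g (x(i := a))) x + (\<Sum>k\<in>{..<m}-{i}. cob_dir k (\<lambda>x. g (x(i := a))) x)"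
    unfolding cob_def using assms by (intro sum.remove) auto
  moreover have "cob_dir i (\<lambda>x. g (x(i := a))) x = 0"
    using assms by (simp add: cob_dir_def)
  ultimately show ?thesis
    using * by (simp add: cob_dir_def add.commute)
qed

section \<open>Hemispheres as chains\<close>

text \<open>A chain is represented by the functional summing a cochain over its cells: \<open>cube M i\<close> is the
  cube \<open>[-2M, 2M]\<^sup>i\<close>, and \<open>cap M i\<close> is the upper half of the boundary of the cube
  \<open>[-2M, 2M]\<^bsup>i+1\<^esup>\<close>.\<close>

fun cube :: "nat \<Rightarrow> nat \<Rightarrow> (cell \<Rightarrow> bit) \<Rightarrow> bit" where
  "cube M 0 g = g (\<lambda>_. 0)"
| "cube M (Suc i) g = (\<Sum>j<M. cube M i (\<lambda>x. g (x(i := 2 * int j + 1))) +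
     cube M i (\<lambda>x. g (x(i := - (2 * int j + 1)))))"

fun cap :: "nat \<Rightarrow> nat \<Rightarrow> (cell \<Rightarrow> bit) \<Rightarrow> bit" where
  "cap M 0 g = g ((\<lambda>_. 0)(0 := 2 * int M))"
| "cap M (Suc i) g = (\<Sum>j<M. cap M i (\<lambda>x. g (x(Suc i := 2 * int j + 1))) +
     cap M i (\<lambda>x. g ((neg_cell x)(Suc i := 2 * int j + 1)))) +
     cube M (Suc i) (\<lambda>x. g (x(Suc i := 2 * int M)))"

definition sph :: "nat \<Rightarrow> nat \<Rightarrow> (cell \<Rightarrow> bit) \<Rightarrow> bit" where
  "sph M i g = cap M i g + cap M i (\<lambda>x. g (neg_cell x))"

lemma cube_add: "cube M i (\<lambda>x. g x + g' x) = cube M i g + cube M i g'"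
  by (induction i arbitrary: g g') (simp_all add: sum.distrib algebra_simps)

lemma cap_add: "cap M i (\<lambda>x. g x + g' x) = cap M i g + cap M i g'"
  by (induction i arbitrary: g g')
     (simp_all add: cube_add sum.distrib algebra_simps del: cube.simps(2))

lemma sph_add: "sph M i (\<lambda>x. g x + g' x) = sph M i g + sph M i g'"
  by (simp add: sph_def cap_add algebra_simps)

lemma cube_0 [simp]: "cube M i (\<lambda>_. 0) = 0"
  by (induction i) simp_all

lemma cap_0 [simp]: "cap M i (\<lambda>_. 0) = 0"
  by (induction i) (simp_all del: cube.simps(2))

lemma cap_sum: "cap M i (\<lambda>x. \<Sum>k<(m::nat). g k x) = (\<Sum>k<m. cap M i (g k))"
  by (induction m) (simp_all add: cap_add)

lemma cap_cob: "cap M j (\<lambda>y. cob m (\<lambda>x. F x y) x) = cob m (\<lambda>x. cap M j (F x)) x"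
  unfolding cob_def cap_sum cob_dir_def by (intro sum.cong) (auto simp: cap_add)

text \<open>Allows for both halves of the \<open>i\<close>-sphere, so that it is invariant under
  \<open>neg_cell\<close> and also serves for \<open>sph\<close>.\<close>

definition on_cap :: "nat \<Rightarrow> nat \<Rightarrow> cell \<Rightarrow> bool" where
  "on_cap M i x \<longleftrightarrow> (\<forall>k>i. x k = 0) \<and> (\<exists>k\<le>i. \<bar>x k\<bar> = 2 * int M)"

lemma on_cap_neg [simp]: "on_cap M i (neg_cell x) = on_cap M i x"
  by (simp add: on_cap_def neg_cell_apply)

lemma cube_cong:
  assumes "\<And>x. \<forall>k\<ge>i. x k = 0 \<Longrightarrow> g x = g' x"
  shows "cube M i g = cube M i g'"
  using assms
proof (induction i arbitrary: g g')
  case (Suc i)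
  have "cube M i (\<lambda>x. g (x(i := a))) = cube M i (\<lambda>x. g' (x(i := a)))" for a
    by (intro Suc.IH Suc.prems) auto
  then show ?case
    by simp
qed simp

lemma cap_cong:
  assumes "\<And>x. on_cap M i x \<Longrightarrow> g x = g' x"
  shows "cap M i g = cap M i g'"
  using assms
proof (induction i arbitrary: g g')
  case 0
  have "on_cap M 0 ((\<lambda>_. 0)(0 := 2 * int M))"
    by (simp add: on_cap_def)
  then show ?case
    using 0 by (simp del: fun_upd_apply)
next
  case (Suc i)
  have 1: "on_cap M (Suc i) (x(Suc i := a))" if "on_cap M i x" for x a
  proof -
    from that obtain k where "k \<le> i" "\<bar>x k\<bar> = 2 * int M" by (auto simp: on_cap_def)
    then have "k \<le> Suc i" "\<bar>(x(Suc i := a)) k\<bar> = 2 * int M" by auto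
    then show ?thesis using that unfolding on_cap_def by (metis Suc_lessD fun_upd_apply less_irrefl)
  qed
  have 2: "on_cap M (Suc i) (x(Suc i := 2 * int M))" if "\<forall>k\<ge>Suc i. x k = 0" for x
    using that by (auto simp: on_cap_def)
  have "cube M (Suc i) (\<lambda>x. g (x(Suc i := 2 * int M))) = cube M (Suc i) (\<lambda>x. g' (x(Suc i := 2 * int M)))"
    by (rule cube_cong) (intro Suc.prems 2)
  moreover have "cap M i (\<lambda>x. g (x(Suc i := a))) = cap M i (\<lambda>x. g' (x(Suc i := a)))"
    and "cap M i (\<lambda>x. g ((neg_cell x)(Suc i := a))) = cap M i (\<lambda>x. g' ((neg_cell x)(Suc i := a)))" for a
    by (rule Suc.IH; rule Suc.prems; rule 1; simp only: on_cap_neg)+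
  ultimately show ?case
    by (simp del: cube.simps)
qed

lemma sph_cong:
  assumes "\<And>x. on_cap M i x \<Longrightarrow> g x = g' x"
  shows "sph M i g = sph M i g'"
  unfolding sph_def using assms by (auto intro!: arg_cong2[where f="(+)"] cap_cong)

lemma cube_neg: "cube M i (\<lambda>x. g (neg_cell x)) = cube M i g"
proof (induction i arbitrary: g)
  case (Suc i)
  have "cube M i (\<lambda>x. g (neg_cell (x(i := a)))) = cube M i (\<lambda>x. g (x(i := - a)))" for a
    unfolding neg_cell_upd by (rule Suc.IH)
  then show ?case
    by (simp only: cube.simps minus_minus add.commute)
qed (simp add: neg_cell_def)

lemma sph_neg: "sph M i (\<lambda>x. g (neg_cell x)) = sph M i g"
  by (simp add: sph_def add.commute)

lemma telescope_bit: "(\<Sum>j<M. G (2 * int j + 1 + 1) + G (2 * int j + 1 - 1)) = G (2 * int M) + (G 0 :: bit)"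
  by (induction M) (simp_all add: algebra_simps)

lemma telescope_neg_bit:
  "(\<Sum>j<M. G (- (2 * int j + 1) + 1) + G (- (2 * int j + 1) - 1)) = G (- (2 * int M)) + (G 0 :: bit)"
  using telescope_bit[of "\<lambda>k. G (- k)" M] by (simp add: add.commute)

text \<open>Stokes' formula by slices along the last coordinate: their boundaries form the walls,
  the telescoping sums leave the two lids, and the two terms \<open>B 0\<close> cancel.\<close>

lemma cube_cob:
  assumes "i < m"
  shows "cube M (Suc i) (cob m g) = sph M i g"
  using assms
proof (induction i arbitrary: g)
  case 0
  have "cube M (Suc 0) (cob m g) = (\<Sum>j<M. g ((\<lambda>_. 0)(0 := 2 * int j + 1 + 1)) + g ((\<lambda>_. 0)(0 := 2 * int j + 1 - 1))) +
     (\<Sum>j<M. g ((\<lambda>_. 0)(0 := - (2 * int j + 1) + 1)) + g ((\<lambda>_. 0)(0 := - (2 * int j + 1) - 1)))"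
    using 0 by (simp add: cob_upd cob_eq_0 sum.distrib algebra_simps)
  also have "\<dots> = sph M 0 g"
    unfolding telescope_bit[of "\<lambda>a. g ((\<lambda>_. 0)(0 := a))"] telescope_neg_bit[of "\<lambda>a. g ((\<lambda>_. 0)(0 := a))"]
    by (simp add: sph_def neg_cell_upd neg_cell_def[of "\<lambda>_. 0"])
  finally show ?case .
next
  case (Suc i)
  define B where "B a = cube M (Suc i) (\<lambda>x. g (x(Suc i := a)))" for a
  define S where "S a = sph M i (\<lambda>x. g (x(Suc i := a)))" for a
  have step: "cube M (Suc i) (\<lambda>x. cob m g (x(Suc i := a))) = S a + (B (a + 1) + B (a - 1))"
    if "odd a" for a
  proof -
    have "cube M (Suc i) (\<lambda>x. cob m g (x(Suc i := a))) =
        cube M (Suc i) (\<lambda>x. cob m (\<lambda>x. g (x(Suc i := a))) x + (g (x(Suc i := a + 1)) + g (x(Suc i := a - 1))))"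
      using Suc.prems that by (intro cube_cong) (simp add: cob_upd)
    also have "\<dots> = S a + (B (a + 1) + B (a - 1))"
      unfolding cube_add B_def S_def using Suc by simp
    finally show ?thesis .
  qed
  have odd_step: "odd (2 * int j + 1)" "odd (- (2 * int j + 1))" for j
    by auto
  have "cube M (Suc (Suc i)) (cob m g) =
      (\<Sum>j<M. (S (2 * int j + 1) + (B (2 * int j + 1 + 1) + B (2 * int j + 1 - 1))) +
         (S (- (2 * int j + 1)) + (B (- (2 * int j + 1) + 1) + B (- (2 * int j + 1) - 1))))"
    unfolding cube.simps(2)[of M "Suc i"] step[OF odd_step(1)] step[OF odd_step(2)] ..
  also have "\<dots> = (\<Sum>j<M. S (2 * int j + 1) + S (- (2 * int j + 1)))
      + (B (2 * int M) + B 0) + (B (- (2 * int M)) + B 0)"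
    unfolding telescope_bit[of B, symmetric] telescope_neg_bit[of B, symmetric]
    by (simp only: sum.distrib add_ac)
  also have "\<dots> = (\<Sum>j<M. S (2 * int j + 1) + S (- (2 * int j + 1))) + (B (2 * int M) + B (- (2 * int M)))"
    by (simp add: add_ac)
  also have "\<dots> = sph M (Suc i) g"
  proof -
    have "cap M (Suc i) g = (\<Sum>j<M. S (2 * int j + 1)) + B (2 * int M)"
      by (simp add: S_def B_def sph_def del: cube.simps)
    moreover have "cap M (Suc i) (\<lambda>x. g (neg_cell x)) = (\<Sum>j<M. S (- (2 * int j + 1))) + B (- (2 * int M))"
      using cube_neg[of M "Suc i" "\<lambda>x. g (x(Suc i := - (2 * int M)))"]
      by (simp add: S_def B_def sph_def neg_cell_upd add.commute[where 'a=bit] del: cube.simps)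
    ultimately show ?thesis
      by (simp add: sph_def sum.distrib add_ac)
  qed
  finally show ?case .
qed

text \<open>The two halves have the same boundary, so the sphere is a cycle. Stokes' formula for the
  halves is a premise because this is applied inside the induction that proves it.\<close>

lemma sph_cob_eq_0:
  assumes "\<And>j g. i = Suc j \<Longrightarrow> cap M (Suc j) (cob m g) = sph M j g"
  shows "sph M i (cob m g) = 0"
proof (cases i)
  case 0
  then show ?thesis by (simp add: sph_def cob_neg cob_eq_0)
next
  case (Suc j)
  then show ?thesis using assms by (simp add: sph_def[of M "Suc j"] cob_neg sph_neg)
qed

text \<open>The walls of \<open>cap\<close> stand on the whole \<open>i\<close>-sphere, a cycle, and
  leave only their rims at heights \<open>0\<close> and \<open>2 * int M\<close>; the upper rim
  cancels with the boundary of the lid.\<close>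

lemma cap_cob_Suc:
  assumes "Suc i < m"
  shows "cap M (Suc i) (cob m g) = sph M i g"
  using assms
proof (induction i arbitrary: g rule: less_induct)
  case (less i)
  define S where "S a = sph M i (\<lambda>x. g (x(Suc i := a)))" for a
  have step: "sph M i (\<lambda>x. cob m g (x(Suc i := a))) = S (a + 1) + S (a - 1)" if "odd a" for a
  proof -
    have "sph M i (\<lambda>x. cob m g (x(Suc i := a))) =
        sph M i (\<lambda>x. cob m (\<lambda>x. g (x(Suc i := a))) x + (g (x(Suc i := a + 1)) + g (x(Suc i := a - 1))))"
      using less.prems that by (intro sph_cong) (simp add: cob_upd on_cap_def)
    also have "\<dots> = S (a + 1) + S (a - 1)"
      unfolding sph_add S_def using less by (simp add: sph_cob_eq_0)
    finally show ?thesis .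
  qed
  have "cube M (Suc i) (\<lambda>x. cob m g (x(Suc i := 2 * int M))) =
      cube M (Suc i) (cob m (\<lambda>x. g (x(Suc i := 2 * int M))))"
    using less.prems by (intro cube_cong) (simp add: cob_upd)
  also have "\<dots> = S (2 * int M)"
    using less.prems by (simp add: cube_cob S_def del: cube.simps)
  finally have lid: "cube M (Suc i) (\<lambda>x. cob m g (x(Suc i := 2 * int M))) = S (2 * int M)" .
  have "cap M (Suc i) (cob m g) = (\<Sum>j<M. sph M i (\<lambda>x. cob m g (x(Suc i := 2 * int j + 1)))) + S (2 * int M)"
    by (simp add: lid sph_def del: cube.simps)
  also have "\<dots> = (\<Sum>j<M. S (2 * int j + 1 + 1) + S (2 * int j + 1 - 1)) + S (2 * int M)"
    by (simp add: step)
  also have "\<dots> = S 0"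
    unfolding telescope_bit by (simp add: add_ac)
  also have "\<dots> = sph M i g"
    unfolding S_def by (rule sph_cong) (auto simp: on_cap_def intro!: arg_cong[where f=g])
  finally show ?case .
qed

section \<open>Cochains on flags of cells\<close>

definition prod_cob :: "nat \<Rightarrow> (cell \<times> cell \<Rightarrow> bit) \<Rightarrow> cell \<times> cell \<Rightarrow> bit" where
  "prod_cob m g c = cob m (\<lambda>x. g (x, snd c)) (fst c) + cob m (\<lambda>y. g (fst c, y)) (snd c)"

lemma prod_cob_add: "prod_cob m (\<lambda>c. g c + g' c) c = prod_cob m g c + prod_cob m g' c"
  by (simp add: prod_cob_def cob_add algebra_simps)

lemma prod_cob_const [simp]: "prod_cob m (\<lambda>_. a) c = 0"
  by (simp add: prod_cob_def)

lemma cob_cob_swap: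
  "cob m (\<lambda>x. cob m (F x) y) x = cob m (\<lambda>y. cob m (\<lambda>x. F x y) x) y"
proof -
  have *: "cob_dir k (\<lambda>x. cob m (F x) y) x = cob m (\<lambda>y. cob_dir k (\<lambda>x. F x y) x) y" for k
    by (auto simp: cob_dir_def[of k] cob_add)
  show ?thesis
    unfolding cob_def[of m "\<lambda>x. cob m (F x) y"] * cob_sum[symmetric] by (simp add: cob_def[of m _ x])
qed

lemma prod_cob_prod_cob [simp]: "prod_cob m (prod_cob m g) c = 0"
  by (simp add: prod_cob_def cob_add cob_cob_swap[of m "\<lambda>x y. g (x, y)" "snd c" "fst c"])

definition facet :: "cell \<times> cell \<Rightarrow> cell \<times> cell \<Rightarrow> bool" where
  "facet c c' \<longleftrightarrow>
     (\<exists>k a. odd (fst c k) \<and> \<bar>a - fst c k\<bar> = 1 \<and> c' = ((fst c)(k := a), snd c)) \<or>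
     (\<exists>k a. odd (snd c k) \<and> \<bar>a - snd c k\<bar> = 1 \<and> c' = (fst c, (snd c)(k := a)))"

lemma cob_cong:
  assumes "\<And>k a. odd (x k) \<Longrightarrow> \<bar>a - x k\<bar> = 1 \<Longrightarrow> g (x(k := a)) = g' (x(k := a))"
  shows "cob m g x = cob m g' x"
  unfolding cob_def cob_dir_def using assms by (intro sum.cong) auto

lemma prod_cob_cong:
  assumes "\<And>c'. facet c c' \<Longrightarrow> g c' = g' c'"
  shows "prod_cob m g c = prod_cob m g' c"
proof -
  have "cob m (\<lambda>x. g (x, snd c)) (fst c) = cob m (\<lambda>x. g' (x, snd c)) (fst c)"
    by (rule cob_cong, rule assms) (auto simp: facet_def)
  moreover have "cob m (\<lambda>y. g (fst c, y)) (snd c) = cob m (\<lambda>y. g' (fst c, y)) (snd c)"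
    by (rule cob_cong, rule assms) (auto simp: facet_def)
  ultimately show ?thesis
    by (simp add: prod_cob_def)
qed

text \<open>\<open>flag_sum m r h c\<close> is the sum of \<open>h\<close> over all flags of \<open>r + 1\<close> cells that start with \<open>c\<close>.
  The full flags below \<open>c\<close> are the simplices of the barycentric subdivision of \<open>c\<close>.\<close>

fun flag_sum :: "nat \<Rightarrow> nat \<Rightarrow> ((cell \<times> cell) list \<Rightarrow> bit) \<Rightarrow> cell \<times> cell \<Rightarrow> bit" where
  "flag_sum m 0 h c = h [c]"
| "flag_sum m (Suc r) h c = prod_cob m (flag_sum m r (\<lambda>l. h (c # l))) c"

text \<open>The simplicial coboundary: the recursion runs through the ways of deleting one
  entry.\<close>

fun simp_cob :: "('c list \<Rightarrow> bit) \<Rightarrow> 'c list \<Rightarrow> bit" where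
  "simp_cob h [] = 0"
| "simp_cob h (c # l) = h l + simp_cob (\<lambda>l. h (c # l)) l"

lemma flag_sum_add: "flag_sum m r (\<lambda>l. h l + h' l) c = flag_sum m r h c + flag_sum m r h' c"
proof (induction r arbitrary: h h' c)
  case (Suc r)
  have "flag_sum m r (\<lambda>l. h (c # l) + h' (c # l)) =
      (\<lambda>c'. flag_sum m r (\<lambda>l. h (c # l)) c' + flag_sum m r (\<lambda>l. h' (c # l)) c')"
    by (rule ext) (rule Suc)
  then show ?case
    by (simp add: prod_cob_add)
qed simp

text \<open>Barycentric subdivision is a chain map. Deleting the first cell of a flag gives the
  right-hand side; any other deleted cell can be refilled in an even number of ways.\<close>

lemma flag_sum_simp_cob: "flag_sum m (Suc r) (simp_cob h) c = prod_cob m (flag_sum m r h) c"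
proof (induction r arbitrary: h c)
  case 0
  have "flag_sum m 0 (\<lambda>l. h l + simp_cob (\<lambda>l. h (c # l)) l) = (\<lambda>c'. h [c'] + h [c])"
    and "flag_sum m 0 h = (\<lambda>c'. h [c'])"
    by auto
  then show ?case
    by (simp add: prod_cob_add)
next
  case (Suc r)
  have "flag_sum m (Suc (Suc r)) (simp_cob h) c =
      prod_cob m (\<lambda>c'. flag_sum m (Suc r) h c' + flag_sum m (Suc r) (simp_cob (\<lambda>l. h (c # l))) c') c"
    by (simp only: flag_sum.simps(2)[of m "Suc r"] simp_cob.simps flag_sum_add[abs_def])
  also have "\<dots> = prod_cob m (flag_sum m (Suc r) h) c"
    by (simp only: Suc.IH prod_cob_add prod_cob_prod_cob add_0_right)
  finally show ?case .
qed

lemma flag_sum_cong: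
  assumes "\<And>l. length l = Suc r \<Longrightarrow> hd l = c \<Longrightarrow> successively facet l \<Longrightarrow> h l = h' l"
  shows "flag_sum m r h c = flag_sum m r h' c"
  using assms
proof (induction r arbitrary: h h' c)
  case (Suc r)
  have "flag_sum m r (\<lambda>l. h (c # l)) c' = flag_sum m r (\<lambda>l. h' (c # l)) c'" if "facet c c'" for c'
    using that by (intro Suc.IH Suc.prems) (auto simp: successively_Cons)
  then show ?case
    by (auto intro: prod_cob_cong)
qed simp

definition commutes_with_cob :: "(cell \<times> cell \<Rightarrow> cell \<times> cell) \<Rightarrow> bool" where
  "commutes_with_cob A \<longleftrightarrow> (\<forall>m g c. prod_cob m g (A c) = prod_cob m (\<lambda>c. g (A c)) c)"

lemma commutes_with_cob_neg_fst: "commutes_with_cob (\<lambda>c. (neg_cell (fst c), snd c))"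
  and commutes_with_cob_neg_snd: "commutes_with_cob (\<lambda>c. (fst c, neg_cell (snd c)))"
  by (simp_all add: commutes_with_cob_def prod_cob_def cob_neg)

lemma flag_sum_map:
  assumes "commutes_with_cob A"
  shows "flag_sum m r h (A c) = flag_sum m r (\<lambda>l. h (map A l)) c"
proof (induction r arbitrary: h c)
  case (Suc r)
  have "prod_cob m g (A c) = prod_cob m (\<lambda>c. g (A c)) c" for g
    using assms by (simp only: commutes_with_cob_def)
  then show ?case
    by (simp add: Suc.IH)
qed simp

text \<open>For sign functions \<open>s\<close>, the cochain \<open>sign_changes s\<close> is the cup product \<open>w\<^sub>0 \<union> w\<^sub>1 \<union> \<dots>\<close> of the
  1-cocycles \<open>w\<^sub>i = \<delta> (s i)\<close>. Replacing its last factor \<open>w\<^sub>i\<close> by \<open>s i\<close> gives a primitive, namely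
  \<open>sign_primitive s\<close>. It has one degree less, and
  if an involution flips all signs, then it adds up with its image to the cup product in that degree:
  this is what makes the induction over the dimension of the hemispheres work.\<close>

fun sign_changes :: "(nat \<Rightarrow> 'c \<Rightarrow> bit) \<Rightarrow> 'c list \<Rightarrow> bit" where
  "sign_changes s [] = 0"
| "sign_changes s [a] = 1"
| "sign_changes s (a # b # l) = (s 0 a + s 0 b) * sign_changes (\<lambda>i. s (Suc i)) (b # l)"

fun sign_primitive :: "(nat \<Rightarrow> 'c \<Rightarrow> bit) \<Rightarrow> 'c list \<Rightarrow> bit" where
  "sign_primitive s [] = 1"
| "sign_primitive s [a] = s 0 a"
| "sign_primitive s (a # b # l) = (s 0 a + s 0 b) * sign_primitive (\<lambda>i. s (Suc i)) (b # l)"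

lemma simp_cob_mult: "simp_cob (\<lambda>l. a * h l) l = a * simp_cob h l"
  by (induction l arbitrary: h) (simp_all add: algebra_simps)

lemma sign_primitive_Cons_add:
  "sign_primitive s (a # l) + sign_primitive s (b # l) =
     (s 0 a + s 0 b) * sign_primitive (\<lambda>i. s (Suc i)) l"
  by (cases l) (simp_all add: algebra_simps)

text \<open>The Leibniz rule, all factors but the last being cocycles. One-cell lists need the value
  \<open>1\<close> of \<open>sign_primitive\<close> at \<open>[]\<close>.\<close>

lemma simp_cob_sign_primitive: "simp_cob (sign_primitive s) l = sign_changes s l"
proof (induction s l rule: sign_changes.induct)
  case (3 s a b l)
  let ?s = "\<lambda>i. s (Suc i)"
  have "simp_cob (sign_primitive s) (a # b # l) =
      sign_primitive s (b # l) + (sign_primitive s (a # l)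
       + (s 0 a + s 0 b) * simp_cob (\<lambda>l. sign_primitive ?s (b # l)) l)"
    by (simp add: simp_cob_mult)
  also have "\<dots> = (s 0 a + s 0 b) *
      (sign_primitive ?s l + simp_cob (\<lambda>l. sign_primitive ?s (b # l)) l)"
    using sign_primitive_Cons_add[of s a l b] by (simp add: algebra_simps)
  also have "\<dots> = sign_changes s (a # b # l)"
    using 3 by simp
  finally show ?case .
qed simp_all

text \<open>The flip preserves all differences; it only changes the last factor, by
  \<open>1\<close>.\<close>

lemma sign_primitive_map:
  assumes "\<And>i c. c \<in> set l \<Longrightarrow> s i (A c) = s i c + 1"
  shows "sign_primitive s l + sign_primitive s (map A l) = sign_changes s l"
  using assms
proof (induction s l rule: sign_changes.induct)
  case (3 s a b l)
  have "s 0 (A a) + s 0 (A b) = s 0 a + s 0 b"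
    by (simp add: 3(2) add_ac flip: one_add_one)
  moreover have "sign_primitive (\<lambda>i. s (Suc i)) (b # l) + sign_primitive (\<lambda>i. s (Suc i)) (map A (b # l)) =
      sign_changes (\<lambda>i. s (Suc i)) (b # l)"
    using 3(2) by (intro 3(1)) auto
  ultimately show ?case
    by (simp flip: distrib_left)
qed (simp_all add: add_ac)

lemma sign_changes_nonzero:
  assumes "sign_changes s l \<noteq> 0" "Suc i < length l"
  shows "s i (l ! i) \<noteq> s i (l ! Suc i)"
  using assms
proof (induction s l arbitrary: i rule: sign_changes.induct)
  case (3 s a b l)
  then show ?case
    by (cases i) (auto simp del: bit_not_zero_iff bit_not_one_iff)
qed simp_all

definition on_boundary :: "nat \<Rightarrow> nat \<Rightarrow> cell \<Rightarrow> bool" where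
  "on_boundary M p x \<longleftrightarrow> (\<exists>k\<le>p. \<bar>x k\<bar> = 2 * int M)"

lemma on_cap_imp_on_boundary: "on_cap M i x \<Longrightarrow> i \<le> p \<Longrightarrow> on_boundary M p x"
  unfolding on_cap_def on_boundary_def by (meson order_trans)

text \<open>An odd coordinate is not the one of modulus \<open>2 * int M\<close>.\<close>

lemma on_boundary_upd: "on_boundary M p x \<Longrightarrow> odd (x k) \<Longrightarrow> on_boundary M p (x(k := a))"
  unfolding on_boundary_def by (metis dvd_triv_left even_abs_add_iff fun_upd_apply abs_minus_cancel dvd_abs_iff)

text \<open>The domain on which signs are required to be odd: it contains the hemispheres of
  dimension up to \<open>p\<close> and \<open>q\<close> and is closed under passing to
  facets.\<close>

definition good :: "nat \<Rightarrow> nat \<Rightarrow> nat \<Rightarrow> cell \<times> cell \<Rightarrow> bool" where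
  "good M p q c \<longleftrightarrow> on_boundary M p (fst c) \<and> on_boundary M q (snd c)"

lemma good_facet: "good M p q c \<Longrightarrow> facet c c' \<Longrightarrow> good M p q c'"
  by (auto simp: good_def facet_def intro: on_boundary_upd)

lemma good_flag:
  assumes "successively facet l" "good M p q (hd l)" "c \<in> set l"
  shows "good M p q c"
  using assms
proof (induction l)
  case (Cons a l)
  then show ?case
    by (cases l) (auto intro: good_facet)
qed simp

text \<open>The summand is a coboundary. Stokes' formula leads to the boundary sphere of either
  factor, where antipodal values of the primitive add up to \<open>sign_changes\<close> in one
  degree less; Pascal's rule then closes the induction.\<close>

theorem sum_sign_changes:
  fixes s :: "nat \<Rightarrow> cell \<times> cell \<Rightarrow> bit"
  assumes flip: "\<And>i x y. good M p q (x, y) \<Longrightarrow> s i (neg_cell x, y) = s i (x, y) + 1"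
                "\<And>i x y. good M p q (x, y) \<Longrightarrow> s i (x, neg_cell y) = s i (x, y) + 1"
    and "p < m" "q < m" "i \<le> p" "j \<le> q"
  shows "cap M i (\<lambda>x. cap M j (\<lambda>y. flag_sum m (i + j) (sign_changes s) (x, y))) = of_nat ((i + j) choose i)"
  using assms(5,6)
proof (induction "i + j" arbitrary: i j)
  case 0
  then show ?case by simp
next
  case (Suc r)
  define G where "G = flag_sum m r (sign_primitive s)"
  define Z where "Z i j = cap M i (\<lambda>x. cap M j (\<lambda>y. flag_sum m r (sign_changes s) (x, y)))" for i j
  have half: "flag_sum m r (sign_primitive s) c + flag_sum m r (sign_primitive s) (A c)
      = flag_sum m r (sign_changes s) c"
    if "commutes_with_cob A" "good M p q c" "\<And>i c. good M p q c \<Longrightarrow> s i (A c) = s i c + 1" for A c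
    unfolding flag_sum_map[OF that(1)] flag_sum_add[symmetric]
    by (intro flag_sum_cong sign_primitive_map that(3)) (use that(2) in \<open>auto intro: good_flag\<close>)
  have G1: "G (x, y) + G (neg_cell x, y) = flag_sum m r (sign_changes s) (x, y)" if "good M p q (x, y)" for x y
    using half[OF commutes_with_cob_neg_fst that] flip(1) by (simp add: G_def split_paired_all)
  have G2: "G (x, y) + G (x, neg_cell y) = flag_sum m r (sign_changes s) (x, y)" if "good M p q (x, y)" for x y
    using half[OF commutes_with_cob_neg_snd that] flip(2) by (simp add: G_def split_paired_all)
  have first: "cap M i (\<lambda>x. cap M j (\<lambda>y. cob m (\<lambda>x. G (x, y)) x)) = (case i of 0 \<Rightarrow> 0 | Suc i' \<Rightarrow> Z i' j)"
  proof (cases i)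
    case 0
    then show ?thesis by (simp add: cap_cob[of M j m "\<lambda>x y. G (x, y)"] cob_eq_0)
  next
    case (Suc i')
    have "cap M i (\<lambda>x. cap M j (\<lambda>y. cob m (\<lambda>x. G (x, y)) x)) = sph M i' (\<lambda>x. cap M j (\<lambda>y. G (x, y)))"
      unfolding cap_cob[of M j m "\<lambda>x y. G (x, y)"] Suc
      using Suc Suc.prems assms by (intro cap_cob_Suc) auto
    also have "\<dots> = Z i' j"
      unfolding sph_def Z_def cap_add[symmetric]
      using Suc \<open>i \<le> p\<close> \<open>j \<le> q\<close>
      by (intro cap_cong G1) (auto simp: good_def intro: on_cap_imp_on_boundary)
    finally show ?thesis using Suc by simp
  qed
  have second: "cap M i (\<lambda>x. cap M j (\<lambda>y. cob m (\<lambda>y. G (x, y)) y)) = (case j of 0 \<Rightarrow> 0 | Suc j' \<Rightarrow> Z i j')"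
  proof (cases j)
    case 0
    then show ?thesis by (simp add: cob_eq_0)
  next
    case (Suc j')
    have "cap M j (\<lambda>y. cob m (\<lambda>y. G (x, y)) y) = sph M j' (\<lambda>y. G (x, y))" for x
      unfolding Suc using Suc Suc.prems assms by (intro cap_cob_Suc) auto
    then have "cap M i (\<lambda>x. cap M j (\<lambda>y. cob m (\<lambda>y. G (x, y)) y)) = cap M i (\<lambda>x. sph M j' (\<lambda>y. G (x, y)))"
      by simp
    also have "\<dots> = Z i j'"
      unfolding sph_def Z_def cap_add[symmetric]
      using Suc \<open>i \<le> p\<close> \<open>j \<le> q\<close>
      by (intro cap_cong G2) (auto simp: good_def intro: on_cap_imp_on_boundary)
    finally show ?thesis using Suc by simp
  qed
  have "cap M i (\<lambda>x. cap M j (\<lambda>y. flag_sum m (i + j) (sign_changes s) (x, y))) =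
      cap M i (\<lambda>x. cap M j (\<lambda>y. prod_cob m G (x, y)))"
    unfolding Suc.hyps(2)[symmetric] G_def flag_sum_simp_cob[symmetric]
    by (simp only: simp_cob_sign_primitive[abs_def])
  also have "\<dots> = (case i of 0 \<Rightarrow> 0 | Suc i' \<Rightarrow> Z i' j) + (case j of 0 \<Rightarrow> 0 | Suc j' \<Rightarrow> Z i j')"
    unfolding first[symmetric] second[symmetric] by (simp add: prod_cob_def cap_add)
  also have "\<dots> = of_nat ((i + j) choose i)"
  proof -
    have Z: "Z i' j' = of_nat (r choose i')" if "r = i' + j'" "i' \<le> p" "j' \<le> q" for i' j'
      using Suc.hyps(1)[OF that] that(1) by (simp add: Z_def)
    show ?thesis
    proof (cases i; cases j)
      fix i' j' assume "i = Suc i'" "j = Suc j'"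
      then show ?thesis
        using Suc.hyps(2) Suc.prems Z[of i' j] Z[of i j'] by (simp del: binomial_Suc_Suc add: binomial_Suc_Suc[of "i' + j'" i'] choose_reduce_nat)
    qed (use Suc.hyps(2) Suc.prems Z in auto)
  qed
  finally show ?case .
qed

section \<open>A Borsuk--Ulam theorem for products of two spheres\<close>

lemma exists_sign_changing_flag:
  fixes s :: "nat \<Rightarrow> cell \<times> cell \<Rightarrow> bit"
  assumes "\<And>i x y. good M p q (x, y) \<Longrightarrow> s i (neg_cell x, y) = s i (x, y) + 1"
      and "\<And>i x y. good M p q (x, y) \<Longrightarrow> s i (x, neg_cell y) = s i (x, y) + 1"
    and "odd ((p + q) choose p)"
  obtains l where "length l = Suc (p + q)" "successively facet l" "\<And>c. c \<in> set l \<Longrightarrow> good M p q c"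
    "\<And>i. i < p + q \<Longrightarrow> s i (l ! i) \<noteq> s i (l ! Suc i)"
proof -
  define m where "m = Suc (p + q)"
  have "\<exists>l. length l = Suc (p + q) \<and> successively facet l \<and> good M p q (hd l) \<and> sign_changes s l \<noteq> 0"
  proof (rule ccontr)
    assume no: "\<not> ?thesis"
    have "flag_sum m (p + q) (sign_changes s) (x, y) = 0" if "on_cap M p x" "on_cap M q y" for x y
    proof -
      have "flag_sum m (p + q) (sign_changes s) (x, y) = flag_sum m (p + q) (\<lambda>_. 0) (x, y)"
      proof (rule flag_sum_cong)
        fix l assume "length l = Suc (p + q)" "hd l = (x, y)" "successively facet l"
        moreover have "good M p q (x, y)"
          using that by (auto simp: good_def intro: on_cap_imp_on_boundary)
        ultimately show "sign_changes s l = 0"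
          using no by metis
      qed
      also have "\<dots> = 0"
        using flag_sum_add[of m "p + q" "\<lambda>_. 0" "\<lambda>_. 0" "(x, y)"] by simp
      finally show ?thesis .
    qed
    then have "cap M p (\<lambda>x. cap M q (\<lambda>y. flag_sum m (p + q) (sign_changes s) (x, y))) =
        cap M p (\<lambda>x. cap M q (\<lambda>y. 0))"
      by (intro cap_cong)
    moreover have "cap M p (\<lambda>x. cap M q (\<lambda>y. flag_sum m (p + q) (sign_changes s) (x, y))) =
        of_nat ((p + q) choose p)"
      by (rule sum_sign_changes) (use assms in \<open>auto simp: m_def\<close>)
    moreover have "(of_nat ((p + q) choose p) :: bit) = 1"
      using assms(3) by (auto elim!: oddE)
    ultimately show False
      by simp
  qed
  then show ?thesis
    using that sign_changes_nonzero good_flag by (metis Suc_less_eq)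
qed

section \<open>From flags of cells to nearby points of the spheres\<close>

lemma facet_dist:
  assumes "facet c c'"
  shows "\<bar>fst c k - fst c' k\<bar> \<le> 1" "\<bar>snd c k - snd c' k\<bar> \<le> 1"
  using assms by (auto simp: facet_def abs_minus_commute)

lemma flag_dist:
  assumes "successively facet l" "i < length l"
  shows "\<bar>fst (l ! i) k - fst (l ! 0) k\<bar> \<le> int i" "\<bar>snd (l ! i) k - snd (l ! 0) k\<bar> \<le> int i"
proof -
  have "\<bar>fst (l ! i) k - fst (l ! 0) k\<bar> \<le> int i \<and> \<bar>snd (l ! i) k - snd (l ! 0) k\<bar> \<le> int i"
    using assms(2)
  proof (induction i)
    case (Suc i)
    then have "facet (l ! i) (l ! Suc i)"
      using assms(1) by (simp add: successively_conv_nth)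
    from facet_dist[OF this, of k] Suc show ?case
      by auto
  qed simp
  then show "\<bar>fst (l ! i) k - fst (l ! 0) k\<bar> \<le> int i" "\<bar>snd (l ! i) k - snd (l ! 0) k\<bar> \<le> int i"
    by auto
qed

text \<open>Embeds the grid along an enumeration \<open>e\<close> of the basis; \<open>sgn\<close>
  will project the boundary of the cube radially to the unit sphere.\<close>

definition cell_point :: "(nat \<Rightarrow> 'a::euclidean_space) \<Rightarrow> nat \<Rightarrow> cell \<Rightarrow> 'a" where
  "cell_point e p x = (\<Sum>k\<le>p. of_int (x k) *\<^sub>R e k)"

lemma cell_point_neg: "cell_point e p (neg_cell x) = - cell_point e p x"
  by (simp add: cell_point_def neg_cell_apply sum_negf)

lemma norm_cell_point_ge:
  fixes e :: "nat \<Rightarrow> 'a::euclidean_space"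
  assumes "bij_betw e {..p} Basis" "on_boundary M p x"
  shows "2 * real M \<le> norm (cell_point e p x)"
proof -
  obtain k where k: "k \<le> p" "\<bar>x k\<bar> = 2 * int M"
    using assms(2) by (auto simp: on_boundary_def)
  have "e j \<bullet> e k = (if j = k then 1 else 0)" if "j \<le> p" for j
    using assms(1) that k(1) unfolding bij_betw_def inj_on_def
    by (metis atMost_iff imageI inner_Basis)
  then have "cell_point e p x \<bullet> e k = (\<Sum>j\<le>p. if j = k then of_int (x k) else 0)"
    unfolding cell_point_def inner_sum_left by (intro sum.cong) auto
  also have "\<dots> = of_int (x k)"
    using k by simp
  finally have "\<bar>cell_point e p x \<bullet> e k\<bar> = 2 * real M"
    using k(2) by (metis of_int_abs of_int_mult of_int_numeral of_int_of_nat_eq)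
  moreover have "\<bar>cell_point e p x \<bullet> e k\<bar> \<le> norm (cell_point e p x)"
    using assms(1) k(1) by (intro Basis_le_norm) (auto simp: bij_betw_def)
  ultimately show ?thesis by simp
qed

lemma norm_cell_point_diff_le:
  fixes e :: "nat \<Rightarrow> 'a::euclidean_space"
  assumes "bij_betw e {..p} Basis" "\<And>k. \<bar>x k - y k\<bar> \<le> int n"
  shows "norm (cell_point e p x - cell_point e p y) \<le> real (Suc p) * real n"
proof -
  have "norm (cell_point e p x - cell_point e p y) = norm (\<Sum>k\<le>p. of_int (x k - y k) *\<^sub>R e k)"
    by (simp add: cell_point_def scaleR_diff_left sum_subtractf)
  also have "\<dots> \<le> (\<Sum>k\<le>p. real n)"
  proof (rule sum_norm_le)
    fix k assume "k \<in> {..p}"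
    then have "norm (e k) = 1"
      using assms(1) by (intro norm_Basis) (auto simp: bij_betw_def)
    moreover have "real_of_int \<bar>x k - y k\<bar> \<le> real_of_int (int n)"
      using assms(2) by (simp only: of_int_le_iff)
    ultimately show "norm (of_int (x k - y k) *\<^sub>R e k) \<le> real n"
      by simp
  qed
  finally show ?thesis by simp
qed

lemma norm_sgn_diff_le:
  fixes a b :: "'a::real_normed_vector"
  assumes "a \<noteq> 0" "b \<noteq> 0"
  shows "norm (sgn a - sgn b) \<le> 2 * norm (a - b) / norm a"
proof -
  have "sgn a - sgn b = (a - b) /\<^sub>R norm a + (1 / norm a - 1 / norm b) *\<^sub>R b"
    by (simp add: sgn_div_norm algebra_simps divide_inverse)
  then have "norm (sgn a - sgn b) \<le> norm ((a - b) /\<^sub>R norm a) + norm ((1 / norm a - 1 / norm b) *\<^sub>R b)"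
    by (simp only: norm_triangle_ineq)
  also have "norm ((1 / norm a - 1 / norm b) *\<^sub>R b) = \<bar>norm b - norm a\<bar> / norm a"
    using assms by (simp add: field_simps abs_mult[symmetric] abs_divide)
  also have "\<dots> \<le> norm (a - b) / norm a"
    by (intro divide_right_mono) (use norm_triangle_ineq3[of b a] in \<open>simp_all add: norm_minus_commute\<close>)
  finally show ?thesis
    by (simp add: divide_inverse mult.commute)
qed

text \<open>Boundary cells have norm at least \<open>2 * real M\<close>, so radial projection brings
  nearby cells together as \<open>M\<close> grows.\<close>

lemma dist_sgn_cell_point_le:
  fixes e :: "nat \<Rightarrow> 'a::euclidean_space"
  assumes "bij_betw e {..p} Basis" "on_boundary M p x" "on_boundary M p y" "M > 0"
    and "\<And>k. \<bar>x k - y k\<bar> \<le> int n"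
  shows "dist (sgn (cell_point e p x)) (sgn (cell_point e p y)) \<le> real (Suc p) * real n / real M"
proof -
  have x: "2 * real M \<le> norm (cell_point e p x)" and y: "2 * real M \<le> norm (cell_point e p y)"
    using assms norm_cell_point_ge by blast+
  then have nz: "cell_point e p x \<noteq> 0" "cell_point e p y \<noteq> 0"
    using assms(4) by auto
  have "dist (sgn (cell_point e p x)) (sgn (cell_point e p y)) \<le>
      2 * norm (cell_point e p x - cell_point e p y) / norm (cell_point e p x)"
    unfolding dist_norm by (rule norm_sgn_diff_le[OF nz])
  also have "\<dots> \<le> 2 * (real (Suc p) * real n) / (2 * real M)"
    using norm_cell_point_diff_le[OF assms(1,5)] x assms(4) by (intro frac_le) auto
  finally show ?thesis by simp
qed

text \<open>Selects one of two antipodal nonzero cells, so whether its values at two nonzero cells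
  agree is reversed by negating either cell.\<close>

definition first_positive :: "cell \<Rightarrow> bool" where
  "first_positive x \<longleftrightarrow> x (LEAST k. x k \<noteq> 0) > 0"

lemma first_positive_neg:
  assumes "\<exists>k. x k \<noteq> 0"
  shows "first_positive (neg_cell x) \<longleftrightarrow> \<not> first_positive x"
proof -
  have "x (LEAST k. x k \<noteq> 0) \<noteq> 0"
    using assms by (rule LeastI_ex)
  then show ?thesis
    by (auto simp: first_positive_def neg_cell_apply)
qed

text \<open>The tie-breaking by \<open>first_positive\<close> keeps the signs equivariant at zeros of \<open>f\<close>.\<close>

definition cell_sign :: "(cell \<Rightarrow> cell \<Rightarrow> real) \<Rightarrow> cell \<times> cell \<Rightarrow> bit" where
  "cell_sign f c = of_bool (f (fst c) (snd c) > 0 \<or>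
     f (fst c) (snd c) = 0 \<and> first_positive (fst c) = first_positive (snd c))"

lemma of_bool_Not_bit: "of_bool (\<not> P) = (of_bool P + 1 :: bit)"
  by (cases P) auto

lemma cell_sign_neg:
  assumes "\<exists>k. x k \<noteq> 0" "\<exists>k. y k \<noteq> 0"
  shows "f (neg_cell x) y = - f x y \<Longrightarrow> cell_sign f (neg_cell x, y) = cell_sign f (x, y) + 1"
    and "f x (neg_cell y) = - f x y \<Longrightarrow> cell_sign f (x, neg_cell y) = cell_sign f (x, y) + 1"
  unfolding cell_sign_def of_bool_Not_bit[symmetric] using assms
  by (auto simp: first_positive_neg intro!: arg_cong[where f=of_bool])

lemma cell_sign_neqD:
  assumes "cell_sign f c \<noteq> cell_sign f c'"
  shows "f (fst c) (snd c) \<le> 0 \<and> 0 \<le> f (fst c') (snd c') \<or> 0 \<le> f (fst c) (snd c) \<and> f (fst c') (snd c') \<le> 0"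
  using assms by (auto simp: cell_sign_def of_bool_def split: if_splits)

lemma uniformly_continuous_on_finite_family:
  fixes g :: "nat \<Rightarrow> 'a::metric_space \<Rightarrow> 'b::metric_space"
  assumes "\<And>k. k < n \<Longrightarrow> uniformly_continuous_on K (g k)" "\<epsilon> > 0"
  obtains \<eta> where "\<eta> > 0" "\<And>k z w. k < n \<Longrightarrow> z \<in> K \<Longrightarrow> w \<in> K \<Longrightarrow> dist w z < \<eta> \<Longrightarrow> dist (g k w) (g k z) < \<epsilon>"
  using assms(1)
proof (induction n arbitrary: thesis)
  case 0
  then show ?case using zero_less_one by blast
next
  case (Suc n)
  obtain \<eta> where 1: "\<eta> > 0"
    "\<And>k z w. k < n \<Longrightarrow> z \<in> K \<Longrightarrow> w \<in> K \<Longrightarrow> dist w z < \<eta> \<Longrightarrow> dist (g k w) (g k z) < \<epsilon>"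
    using Suc.IH Suc.prems(2) by (metis less_SucI)
  obtain \<eta>' where 2: "\<eta>' > 0" "\<And>z w. z \<in> K \<Longrightarrow> w \<in> K \<Longrightarrow> dist w z < \<eta>' \<Longrightarrow> dist (g n w) (g n z) < \<epsilon>"
    using Suc.prems(2)[of n] assms(2) unfolding uniformly_continuous_on_def by blast
  show ?case
    by (rule Suc.prems(1)[of "min \<eta> \<eta>'"]) (use 1 2 in \<open>auto simp: less_Suc_eq\<close>)
qed

text \<open>Without a zero, the sum of the moduli has a positive minimum. On a fine grid, all
  coordinates change sign along one short flag and are therefore too small there.\<close>

theorem common_zero_of_biodd_maps:
  fixes f :: "nat \<Rightarrow> 'a::euclidean_space \<Rightarrow> 'b::euclidean_space \<Rightarrow> real"
  assumes dims: "DIM('a) = Suc p" "DIM('b) = Suc q"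
    and binom: "odd ((p + q) choose p)"
    and cont: "\<And>k. k < p + q \<Longrightarrow> continuous_on (sphere 0 1 \<times> sphere 0 1) (\<lambda>z. f k (fst z) (snd z))"
    and odd1: "\<And>k u v. k < p + q \<Longrightarrow> norm u = 1 \<Longrightarrow> norm v = 1 \<Longrightarrow> f k (- u) v = - f k u v"
    and odd2: "\<And>k u v. k < p + q \<Longrightarrow> norm u = 1 \<Longrightarrow> norm v = 1 \<Longrightarrow> f k u (- v) = - f k u v"
  shows "\<exists>u v. norm u = 1 \<and> norm v = 1 \<and> (\<forall>k<p + q. f k u v = 0)"
proof (rule ccontr)
  define n where "n = p + q"
  define K where "K = (sphere 0 1 :: 'a set) \<times> (sphere 0 1 :: 'b set)"
  define g where "g k z = f k (fst z) (snd z)" for k z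
  assume "\<not> ?thesis"
  then have nz: "\<exists>k<n. g k z \<noteq> 0" if "z \<in> K" for z
    using that by (auto simp: K_def g_def n_def)
  obtain ea :: "nat \<Rightarrow> 'a" where ea: "bij_betw ea {..p} Basis"
    using bij_betw_from_nat_into_finite[of "Basis :: 'a set"] dims(1)
    by (metis finite_Basis lessThan_Suc_atMost)
  obtain eb :: "nat \<Rightarrow> 'b" where eb: "bij_betw eb {..q} Basis"
    using bij_betw_from_nat_into_finite[of "Basis :: 'b set"] dims(2)
    by (metis finite_Basis lessThan_Suc_atMost)
  have cK: "compact K" and neK: "K \<noteq> {}"
    by (auto simp: K_def compact_Times)
  have cg: "continuous_on K (g k)" if "k < n" for k
    using cont[of k] that by (simp add: n_def K_def g_def[abs_def])
  have "continuous_on K (\<lambda>z. \<Sum>k<n. \<bar>g k z\<bar>)"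
    by (intro continuous_intros cg) auto
  then obtain z0 where z0: "z0 \<in> K" "\<And>z. z \<in> K \<Longrightarrow> (\<Sum>k<n. \<bar>g k z0\<bar>) \<le> (\<Sum>k<n. \<bar>g k z\<bar>)"
    using continuous_attains_inf[OF cK neK] by blast
  define \<delta> where "\<delta> = (\<Sum>k<n. \<bar>g k z0\<bar>)"
  obtain k0 where k0: "k0 < n" "g k0 z0 \<noteq> 0"
    using nz z0(1) by blast
  then have "\<delta> > 0" "n > 0"
    unfolding \<delta>_def by (auto intro!: sum_pos2[where i = k0])
  define \<epsilon> where "\<epsilon> = \<delta> / real n"
  have "\<epsilon> > 0"
    using \<open>\<delta> > 0\<close> \<open>n > 0\<close> by (simp add: \<epsilon>_def)
  obtain \<eta> where \<eta>: "\<eta> > 0"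
    "\<And>k z w. k < n \<Longrightarrow> z \<in> K \<Longrightarrow> w \<in> K \<Longrightarrow> dist w z < \<eta> \<Longrightarrow> dist (g k w) (g k z) < \<epsilon>"
    using uniformly_continuous_on_finite_family[of n K g \<epsilon>] \<open>\<epsilon> > 0\<close> cg cK
    by (metis compact_uniformly_continuous)
  \<comment> \<open>\<open>R / real M\<close> will bound the distance of any point of the flag from
    its first point, since cells of a flag differ by at most \<open>n\<close> in each
    coordinate.\<close>
  define R where "R = real (Suc p) * real n + real (Suc q) * real n"
  obtain M0 :: nat where M0: "R / \<eta> < real M0"
    using reals_Archimedean2 by blast
  define M where "M = Suc M0"
  have M: "M > 0" "R / real M < \<eta>"
    using M0 \<eta>(1) by (auto simp: M_def field_simps)
  define P where "P c = (sgn (cell_point ea p (fst c)), sgn (cell_point eb q (snd c)))" for c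
  define F where "F k x y = f k (sgn (cell_point ea p x)) (sgn (cell_point eb q y))" for k x y
  \<comment> \<open>The flag lemma asks for odd signs at every index; those from \<open>n\<close> on
    just repeat index \<open>k0\<close>.\<close>
  define s where "s k = (if k < n then cell_sign (F k) else cell_sign (F k0))" for k
  have nrm: "norm (sgn (cell_point ea p x)) = 1" "norm (sgn (cell_point eb q y)) = 1"
    "\<exists>k. x k \<noteq> 0" "\<exists>k. y k \<noteq> 0" if "good M p q (x, y)" for x y
    using that norm_cell_point_ge[OF ea, of M x] norm_cell_point_ge[OF eb, of M y] M(1)
    by (auto simp: good_def norm_sgn on_boundary_def) (metis abs_0 mult_eq_0_iff of_nat_eq_0_iff zero_neq_numeral neq0_conv)+
  have oddF: "F k (neg_cell x) y = - F k x y" "F k x (neg_cell y) = - F k x y"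
    if "k < n" "good M p q (x, y)" for k x y
    using nrm[OF that(2)] that(1) odd1 odd2 by (simp_all add: F_def cell_point_neg sgn_minus n_def)
  have s1: "s k (neg_cell x, y) = s k (x, y) + 1" if "good M p q (x, y)" for k x y
    using nrm(3,4)[OF that] oddF(1)[OF _ that] k0(1) by (simp add: s_def cell_sign_neg(1))
  have s2: "s k (x, neg_cell y) = s k (x, y) + 1" if "good M p q (x, y)" for k x y
    using nrm(3,4)[OF that] oddF(2)[OF _ that] k0(1) by (simp add: s_def cell_sign_neg(2))
  obtain l where l: "length l = Suc n" "successively facet l" "\<And>c. c \<in> set l \<Longrightarrow> good M p q c"
    "\<And>k. k < n \<Longrightarrow> s k (l ! k) \<noteq> s k (l ! Suc k)"
    using exists_sign_changing_flag[of M p q s] s1 s2 binom unfolding n_def by blast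
  have gl: "good M p q (l ! k)" if "k \<le> n" for k
    using that l(1,3) by simp
  have inK: "P (l ! k) \<in> K" if "k \<le> n" for k
    using nrm(1,2)[of "fst (l ! k)" "snd (l ! k)"] gl[OF that] by (simp add: P_def K_def)
  have near: "dist (P (l ! k)) (P (l ! 0)) < \<eta>" if "k \<le> n" for k
  proof -
    have kl: "k < length l"
      using that l(1) by simp
    have d: "\<bar>fst (l ! k) j - fst (l ! 0) j\<bar> \<le> int n" "\<bar>snd (l ! k) j - snd (l ! 0) j\<bar> \<le> int n" for j
      using flag_dist[OF l(2) kl, of j] that by auto
    have "dist (P (l ! k)) (P (l ! 0)) \<le>
        dist (fst (P (l ! k))) (fst (P (l ! 0))) + dist (snd (P (l ! k))) (snd (P (l ! 0)))"
      unfolding dist_prod_def by (rule sqrt_sum_squares_le_sum) auto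
    also have "\<dots> \<le> real (Suc p) * real n / real M + real (Suc q) * real n / real M"
      unfolding P_def fst_conv snd_conv
      by (intro add_mono dist_sgn_cell_point_le ea eb M d)
         (use gl[OF that] gl[of 0] in \<open>auto simp: good_def\<close>)
    also have "\<dots> = R / real M"
      by (simp add: R_def add_divide_distrib)
    finally show ?thesis
      using M(2) by simp
  qed
  have small: "\<bar>g k (P (l ! 0))\<bar> < \<epsilon>" if "k < n" for k
  proof -
    have "dist (g k (P (l ! k))) (g k (P (l ! 0))) < \<epsilon>" "dist (g k (P (l ! Suc k))) (g k (P (l ! 0))) < \<epsilon>"
      using that by (intro \<eta>(2) inK near; simp)+
    moreover have "cell_sign (F k) (l ! k) \<noteq> cell_sign (F k) (l ! Suc k)"
      using l(4)[OF that] that by (simp add: s_def)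
    from cell_sign_neqD[OF this]
    have "g k (P (l ! k)) \<le> 0 \<and> 0 \<le> g k (P (l ! Suc k)) \<or> 0 \<le> g k (P (l ! k)) \<and> g k (P (l ! Suc k)) \<le> 0"
      by (simp add: F_def g_def P_def)
    \<comment> \<open>Two values of weakly opposite sign both lie within \<open>\<epsilon>\<close>
      of the value at the first cell.\<close>
    ultimately show ?thesis
      unfolding dist_real_def by linarith
  qed
  have "\<delta> \<le> (\<Sum>k<n. \<bar>g k (P (l ! 0))\<bar>)"
    unfolding \<delta>_def by (intro z0 inK) simp
  also have "\<dots> < (\<Sum>k<n. \<epsilon>)"
    using small \<open>n > 0\<close> by (intro sum_strict_mono) auto
  also have "\<dots> = \<delta>"
    using \<open>n > 0\<close> by (simp add: \<epsilon>_def)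
  finally show False by simp
qed

section \<open>The correlation of two hyperplanes\<close>

definition side :: "(real ^ 'n) \<times> real \<Rightarrow> real ^ 'n \<Rightarrow> real" where
  "side H x = sgn (x \<bullet> fst H - snd H)"

lemma side_uminus: "side (- H) x = - side H x"
  by (simp add: side_def flip: sgn_minus)

lemma side_measurable [measurable]: "side H \<in> borel_measurable borel"
  unfolding side_def[abs_def] by measurable

lemma side_eq: "side H x = indicator (pos_half H) x - indicator (neg_half H) x"
  by (auto simp: side_def pos_half_def neg_half_def sgn_if indicator_def)

lemma mass_finite_measure: "mass \<mu> \<Longrightarrow> finite_measure \<mu>"
  by (rule finite_measureI) (use sets_eq_imp_space_eq[of \<mu> borel] in \<open>auto simp: mass_def\<close>)

text \<open>\<open>side\<close> is the difference of the two indicators even on the hyperplane,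
  where both closed halfspaces contribute and cancel.\<close>

lemma rho_eq_integral:
  fixes \<mu> :: "(real ^ 'n) measure"
  assumes "mass \<mu>"
  shows "rho \<mu> H\<^sub>1 H\<^sub>2 = (\<integral>x. side H\<^sub>1 x * side H\<^sub>2 x \<partial>\<mu>)"
proof -
  interpret finite_measure \<mu>
    using assms by (rule mass_finite_measure)
  have sets: "sets \<mu> = sets borel"
    using assms by (simp add: mass_def)
  have space: "space \<mu> = UNIV"
    using sets_eq_imp_space_eq[OF sets] by simp
  have half: "pos_half H \<in> sets \<mu>" "neg_half H \<in> sets \<mu>" for H :: "(real ^ 'n) \<times> real"
    unfolding sets pos_half_def neg_half_def by measurable
  have int: "integrable \<mu> (indicat_real (A \<inter> B))" if "A \<in> sets \<mu>" "B \<in> sets \<mu>" for A B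
    using that by (intro integrable_real_indicator) (auto simp: less_top[symmetric])
  have "side H\<^sub>1 x * side H\<^sub>2 x =
      indicator (pos_half H\<^sub>1 \<inter> pos_half H\<^sub>2) x + indicator (neg_half H\<^sub>1 \<inter> neg_half H\<^sub>2) x
      - indicator (pos_half H\<^sub>1 \<inter> neg_half H\<^sub>2) x - indicator (neg_half H\<^sub>1 \<inter> pos_half H\<^sub>2) x" for x
    by (simp add: side_eq indicator_inter_arith algebra_simps)
  then show ?thesis
    by (simp add: rho_def space half int)
qed

lemma rho_uminus:
  assumes "mass \<mu>"
  shows "rho \<mu> (- H\<^sub>1) H\<^sub>2 = - rho \<mu> H\<^sub>1 H\<^sub>2" and "rho \<mu> H\<^sub>1 (- H\<^sub>2) = - rho \<mu> H\<^sub>1 H\<^sub>2"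
  using assms by (simp_all add: rho_eq_integral side_uminus)

lemma mass_AE_not_on_hyperplane:
  assumes "mass \<mu>" "H \<noteq> 0"
  shows "AE x in \<mu>. x \<bullet> fst H - snd H \<noteq> 0"
proof (cases "fst H = 0")
  \<comment> \<open>A degenerate hyperplane has nonzero offset, so no point lies on it.\<close>
  case True
  then show ?thesis
    using assms(2) by (simp add: prod_eq_iff)
next
  case False
  have "{x. x \<bullet> fst H = snd H} \<in> null_sets \<mu>"
    using assms(1) False by (auto simp: null_sets_def mass_def)
  then show ?thesis
    by (rule AE_I') auto
qed

text \<open>Dominated convergence: \<open>sgn\<close> jumps only at \<open>0\<close>, so pointwise
  convergence can fail only on the two limit hyperplanes, which are null sets.\<close>

lemma continuous_on_rho:
  fixes \<mu> :: "(real ^ 'n) measure"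
  assumes "mass \<mu>"
  shows "continuous_on (hyperplanes \<times> hyperplanes) (\<lambda>z. rho \<mu> (fst z) (snd z))"
  unfolding continuous_on_sequentially
proof (intro allI ballI impI)
  fix X and z :: "((real ^ 'n) \<times> real) \<times> ((real ^ 'n) \<times> real)"
  assume z: "z \<in> hyperplanes \<times> hyperplanes" and X: "(\<forall>n. X n \<in> hyperplanes \<times> hyperplanes) \<and> X \<longlonglongrightarrow> z"
  interpret finite_measure \<mu>
    using assms by (rule mass_finite_measure)
  have sets [measurable_cong]: "sets \<mu> = sets borel"
    using assms by (simp add: mass_def)
  have "fst z \<noteq> 0" "snd z \<noteq> 0"
    using z by (auto simp: hyperplanes_def)
  then have "AE x in \<mu>. x \<bullet> fst (fst z) - snd (fst z) \<noteq> 0 \<and> x \<bullet> fst (snd z) - snd (snd z) \<noteq> 0"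
    unfolding AE_conj_iff using mass_AE_not_on_hyperplane[OF assms] by blast
  then have "AE x in \<mu>. (\<lambda>n. side (fst (X n)) x * side (snd (X n)) x) \<longlonglongrightarrow> side (fst z) x * side (snd z) x"
    by eventually_elim (unfold side_def, use X in \<open>intro tendsto_intros; auto\<close>)
  then have "(\<lambda>n. \<integral>x. side (fst (X n)) x * side (snd (X n)) x \<partial>\<mu>) \<longlonglongrightarrow> (\<integral>x. side (fst z) x * side (snd z) x \<partial>\<mu>)"
    by (intro integral_dominated_convergence[where w = "\<lambda>_. 1"])
       (auto simp: side_def sgn_if abs_mult)
  then show "((\<lambda>z. rho \<mu> (fst z) (snd z)) \<circ> X) \<longlonglongrightarrow> rho \<mu> (fst z) (snd z)"
    using assms by (simp add: rho_eq_integral o_def)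
qed

section \<open>Radon partitions\<close>

text \<open>Radon's argument: the positive and the negative part have the same total weight
  \<open>s\<close>, and dividing by it writes one point \<open>w\<close> as a convex combination in
  two ways.\<close>

lemma affine_dependence_convex_hulls_meet:
  fixes x :: "'i \<Rightarrow> 'a::real_vector"
  assumes "finite I" and sum0: "(\<Sum>i\<in>I. y i) = 0" and lin0: "(\<Sum>i\<in>I. y i *\<^sub>R x i) = 0"
    and "\<exists>i\<in>I. y i \<noteq> 0"
  shows "convex hull (x ` {i\<in>I. y i > 0}) \<inter> convex hull (x ` {i\<in>I. y i < 0}) \<noteq> {}"
proof -
  define S where "S = {i\<in>I. y i > 0}"
  define T where "T = {i\<in>I. y i < 0}"
  have fin: "finite S" "finite T" and disj: "S \<inter> T = {}"
    using assms(1) by (auto simp: S_def T_def)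
  have split: "(\<Sum>i\<in>I. g i) = (\<Sum>i\<in>S. g i) + (\<Sum>i\<in>T. g i)" if "\<And>i. y i = 0 \<Longrightarrow> g i = 0"
    for g :: "'i \<Rightarrow> 'b::real_vector"
  proof -
    have "(\<Sum>i\<in>I. g i) = (\<Sum>i\<in>S \<union> T. g i)"
      using assms(1) that by (intro sum.mono_neutral_right) (force simp: S_def T_def)+
    then show ?thesis
      using fin disj by (simp add: sum.union_disjoint)
  qed
  define s where "s = (\<Sum>i\<in>S. y i)"
  have sT: "s = (\<Sum>i\<in>T. - y i)"
    using split[of y] sum0 by (simp add: s_def sum_negf)
  have "S \<noteq> {}"
  proof
    assume "S = {}"
    then have "(\<Sum>i\<in>T. - y i) = 0"
      using sT by (simp add: s_def)
    moreover have "\<forall>i\<in>T. 0 \<le> - y i"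
      by (auto simp: T_def)
    ultimately have "\<forall>i\<in>T. - y i = 0"
      using fin(2) by (simp add: sum_nonneg_eq_0_iff)
    then have "T = {}"
      by (auto simp: T_def)
    with \<open>S = {}\<close> assms(4) show False
      unfolding S_def T_def by (auto simp: neq_iff)
  qed
  then have "s > 0"
    unfolding s_def using fin by (intro sum_pos) (auto simp: S_def)
  define w where "w = (\<Sum>i\<in>S. (y i / s) *\<^sub>R x i)"
  have "(\<Sum>i\<in>S. y i *\<^sub>R x i) = (\<Sum>i\<in>T. (- y i) *\<^sub>R x i)"
    using split[of "\<lambda>i. y i *\<^sub>R x i"] lin0 by (simp add: sum_negf add_eq_0_iff2)
  then have "(1 / s) *\<^sub>R (\<Sum>i\<in>S. y i *\<^sub>R x i) = (1 / s) *\<^sub>R (\<Sum>i\<in>T. (- y i) *\<^sub>R x i)"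
    by simp
  then have wT: "w = (\<Sum>i\<in>T. (- y i / s) *\<^sub>R x i)"
    unfolding w_def scaleR_sum_right scaleR_scaleR by simp
  have "w \<in> convex hull (x ` S)"
    unfolding w_def using fin \<open>s > 0\<close>
    by (intro convex_sum) (auto simp: S_def s_def hull_inc simp flip: sum_divide_distrib)
  moreover have "(\<Sum>i\<in>T. - y i / s) = 1"
    using \<open>s > 0\<close> unfolding sum_divide_distrib[symmetric] sT[symmetric] by simp
  then have "w \<in> convex hull (x ` T)"
    unfolding wT using fin \<open>s > 0\<close>
    by (intro convex_sum) (auto simp: T_def hull_inc divide_nonpos_pos)
  ultimately show ?thesis
    by (auto simp: S_def T_def)
qed

text \<open>The total shortfall \<open>\<phi>\<close> below \<open>c\<close> has a positive minimum
  on \<open>K\<close>, which \<open>card I\<close> shortfalls of at most \<open>e\<close> cannot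
  reach.\<close>

lemma compact_uniform_upper_bound:
  fixes r :: "'i \<Rightarrow> 'a::topological_space \<Rightarrow> real"
  assumes "compact K" "K \<noteq> {}" "finite I" "\<And>i. i \<in> I \<Longrightarrow> continuous_on K (r i)"
    and "\<And>z. z \<in> K \<Longrightarrow> \<exists>i\<in>I. r i z < c"
  shows "\<exists>a<c. \<forall>z\<in>K. \<exists>i\<in>I. r i z < a"
proof -
  define \<phi> where "\<phi> z = (\<Sum>i\<in>I. max (c - r i z) 0)" for z
  have "continuous_on K \<phi>"
    unfolding \<phi>_def by (intro continuous_intros assms)
  then obtain z0 where z0: "z0 \<in> K" "\<And>z. z \<in> K \<Longrightarrow> \<phi> z0 \<le> \<phi> z"
    using continuous_attains_inf[OF assms(1,2)] by blast
  obtain i where "i \<in> I" "r i z0 < c"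
    using assms(5) z0(1) by blast
  then have pos: "\<phi> z0 > 0"
    unfolding \<phi>_def using assms(3) by (intro sum_pos2[where i = i]) auto
  define e where "e = \<phi> z0 / (real (card I) + 1)"
  have "e > 0"
    using pos by (simp add: e_def)
  have "\<exists>i\<in>I. r i z < c - e" if "z \<in> K" for z
  proof (rule ccontr)
    assume "\<not> ?thesis"
    then have "\<phi> z \<le> (\<Sum>i\<in>I. e)"
      unfolding \<phi>_def using \<open>e > 0\<close> by (intro sum_mono) force
    also have "\<dots> < (real (card I) + 1) * e"
      using \<open>e > 0\<close> by (simp add: algebra_simps)
    also have "\<dots> = \<phi> z0"
      by (simp add: e_def)
    finally show False
      using z0(2)[OF that] by simp
  qed
  then show ?thesis
    using \<open>e > 0\<close> by (intro exI[of _ "c - e"]) auto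
qed

text \<open>Discarding small values outright would create jumps; shrinking the others by
  \<open>a\<close> avoids this and keeps their signs.\<close>

definition soft_threshold :: "real \<Rightarrow> real \<Rightarrow> real" where
  "soft_threshold a r = max (r - a) 0 - max (- r - a) 0"

lemma soft_threshold_uminus: "soft_threshold a (- r) = - soft_threshold a r"
  by (simp add: soft_threshold_def)

lemma soft_threshold_pos_iff: "a \<ge> 0 \<Longrightarrow> soft_threshold a r > 0 \<longleftrightarrow> r > a"
  and soft_threshold_neg_iff: "a \<ge> 0 \<Longrightarrow> soft_threshold a r < 0 \<longleftrightarrow> r < - a"
  by (auto simp: soft_threshold_def max_def)

text \<open>Neighbours in row \<open>2 ^ k - 1\<close> of Pascal's triangle add up to an inner entry
  of row \<open>2 ^ k\<close>, which is even; so all have the parity of the first.\<close>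

lemma odd_binomial_two_power_minus_1:
  assumes "j \<le> 2 ^ k - 1"
  shows "odd ((2 ^ k - 1) choose j)"
  using assms
proof (induction j)
  case (Suc j)
  define C where "C = (2 ^ k :: nat) choose Suc j"
  have "even C"
  proof (rule ccontr)
    assume "odd C"
    then have "coprime (2 ^ k) C"
      by simp
    moreover have "Suc j * C = 2 ^ k * ((2 ^ k - 1) choose j)"
      unfolding C_def using times_binomial_minus1_eq[of "Suc j" "2 ^ k"] by simp
    then have "2 ^ k dvd Suc j * C"
      by simp
    ultimately have "2 ^ k dvd Suc j"
      using coprime_dvd_mult_left_iff by blast
    then have "2 ^ k \<le> Suc j"
      by (intro dvd_imp_le) auto
    with Suc.prems show False
      by (metis One_nat_def diff_less le_trans less_numeral_extra(1) not_le zero_less_numeral zero_less_power)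
  qed
  moreover have "C = ((2 ^ k - 1) choose j) + ((2 ^ k - 1) choose Suc j)"
    unfolding C_def by (subst choose_reduce_nat) auto
  ultimately show ?case
    using Suc by auto
qed simp

(* V is a copy of R^(2d-2), given as a linear subspace of a Euclidean space so that
   d = 1 (where 2d - 2 = 0) is covered: every Euclidean space type has positive dimension. *)
theorem theorem6p3:
  fixes d t m :: nat
    and V :: "'b::euclidean_space set"
    and x :: "nat \<Rightarrow> 'b"
    and \<mu> :: "nat \<Rightarrow> (real ^ 'n) measure"
    and c :: real
  assumes "d = 2 ^ t"
    and "CARD('n) = d"
    and "subspace V" and "dim V = 2 * d - 2"
    and "m \<ge> 1"
    and "\<forall>i\<in>{1..m}. x i \<in> V"
    and "\<forall>i\<in>{1..m}. mass (\<mu> i)"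
    and "c > 0"
    and "\<forall>H\<^sub>1\<in>hyperplanes. \<forall>H\<^sub>2\<in>hyperplanes. \<exists>l\<in>{1..m}. \<bar>rho (\<mu> l) H\<^sub>1 H\<^sub>2\<bar> \<ge> c"
  shows "\<exists>H\<^sub>1\<in>hyperplanes. \<exists>H\<^sub>2\<in>hyperplanes. \<exists>S T.
           S \<subseteq> {1..m} \<and> T \<subseteq> {1..m} \<and> S \<inter> T = {} \<and>
           convex hull (x ` S) \<inter> convex hull (x ` T) \<noteq> {} \<and>
           (\<forall>i\<in>S. rho (\<mu> i) H\<^sub>1 H\<^sub>2 \<ge> c) \<and>
           (\<forall>i\<in>T. rho (\<mu> i) H\<^sub>1 H\<^sub>2 \<le> - c)"
proof (rule ccontr)
  assume no: "\<not> ?thesis"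
  define K :: "(((real ^ 'n) \<times> real) \<times> ((real ^ 'n) \<times> real)) set" where "K = hyperplanes \<times> hyperplanes"
  \<comment> \<open>The candidates for \<open>(S, T)\<close>, finite in number; by
    \<open>no\<close>, each fails one of the inequalities at every pair of hyperplanes.\<close>
  define \<R> where "\<R> = {(S, T). S \<subseteq> {1..m} \<and> T \<subseteq> {1..m} \<and> S \<inter> T = {} \<and>
    convex hull (x ` S) \<inter> convex hull (x ` T) \<noteq> {}}"
  \<comment> \<open>Signed so that the inequalities for \<open>S\<close> and for \<open>T\<close>
    both read \<open>r S i z \<ge> c\<close>.\<close>
  define r where "r S i z = (if i \<in> S then rho (\<mu> i) (fst z) (snd z) else - rho (\<mu> i) (fst z) (snd z))"
    for S i z
  have "compact K" "K \<noteq> {}"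
    by (auto simp: K_def hyperplanes_def compact_Times)
  have rho_cont: "continuous_on K (\<lambda>z. rho (\<mu> i) (fst z) (snd z))" if "i \<in> {1..m}" for i
    unfolding K_def using that assms(7) by (intro continuous_on_rho) auto
  have "\<exists>a<c. \<forall>z\<in>K. \<exists>i\<in>S \<union> T. r S i z < a" if ST: "(S, T) \<in> \<R>" for S T
  proof (rule compact_uniform_upper_bound)
    show "finite (S \<union> T)"
      using ST by (auto simp: \<R>_def intro: finite_subset)
    show "continuous_on K (r S i)" if "i \<in> S \<union> T" for i
      using rho_cont[of i] that ST unfolding r_def[abs_def] \<R>_def
      by (cases "i \<in> S") (auto intro!: continuous_on_minus)
    show "\<exists>i\<in>S \<union> T. r S i z < c" if "z \<in> K" for z
    proof (rule ccontr)
      assume "\<not> ?thesis"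
      then have "(\<forall>i\<in>S. rho (\<mu> i) (fst z) (snd z) \<ge> c) \<and> (\<forall>i\<in>T. rho (\<mu> i) (fst z) (snd z) \<le> - c)"
        using ST by (fastforce simp: r_def \<R>_def not_less)
      then show False
        using no that ST unfolding K_def \<R>_def mem_Times_iff mem_Collect_eq prod.case by blast
    qed
  qed fact+
  then have "\<forall>P\<in>\<R>. \<exists>a<c. \<forall>z\<in>K. \<exists>i\<in>fst P \<union> snd P. r (fst P) i z < a"
    by force
  then obtain \<alpha> where \<alpha>: "\<And>P. P \<in> \<R> \<Longrightarrow> \<alpha> P < c"
    "\<And>P z. P \<in> \<R> \<Longrightarrow> z \<in> K \<Longrightarrow> \<exists>i\<in>fst P \<union> snd P. r (fst P) i z < \<alpha> P"
    by metis
  have "finite \<R>"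
    by (rule finite_subset[of _ "Pow {1..m} \<times> Pow {1..m}"]) (auto simp: \<R>_def)
  \<comment> \<open>One threshold below \<open>c\<close> that dominates the bounds of all
    candidates; the \<open>0\<close> keeps it nonnegative.\<close>
  define a where "a = Max (insert 0 (\<alpha> ` \<R>))"
  have a: "0 \<le> a" "a < c" "\<And>P. P \<in> \<R> \<Longrightarrow> \<alpha> P \<le> a"
    using \<open>finite \<R>\<close> \<alpha>(1) \<open>c > 0\<close> by (auto simp: a_def)

  obtain B where B: "B \<subseteq> V" "pairwise orthogonal B" "card B = dim V" "span B = V" "independent B"
    using orthonormal_basis_subspace[OF assms(3)] by metis
  then have "finite B"
    using independent_imp_finite by blast
  then obtain b where b: "bij_betw b {..<2 * d - 2} B"
    using bij_betw_from_nat_into_finite[of B] B(3) assms(4) by metis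
  \<comment> \<open>\<open>H\<^sub>1\<close> is taken through the origin, so \<open>(u, v)\<close>
    ranges over spheres of dimensions \<open>d - 1\<close> and \<open>d\<close>, as many dimensions
    as there are equations.\<close>
  define Y where "Y i u v = soft_threshold a (rho (\<mu> i) (u, 0) v)" for i u v
  \<comment> \<open>The coordinates in \<open>V\<close> of the weighted sum of the points, and last
    the total weight.\<close>
  define f where "f k u v = (if k < 2 * d - 2 then (\<Sum>i=1..m. Y i u v * (x i \<bullet> b k)) else (\<Sum>i=1..m. Y i u v))"
    for k u v
  have "d > 0"
    using assms(1) by simp
  have n: "(d - 1) + d = 2 * d - 1"
    using \<open>d > 0\<close> by simp
  have Y_odd: "Y i (- u) v = - Y i u v" "Y i u (- v) = - Y i u v" if "i \<in> {1..m}" for i u v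
  proof -
    have "mass (\<mu> i)"
      using that assms(7) by blast
    from rho_uminus[OF this, of "(u, 0)" v]
    show "Y i (- u) v = - Y i u v" "Y i u (- v) = - Y i u v"
      by (simp_all add: Y_def soft_threshold_uminus)
  qed
  have Y_cont: "continuous_on (sphere 0 1 \<times> sphere 0 1) (\<lambda>z. Y i (fst z) (snd z))" if "i \<in> {1..m}" for i
  proof -
    have "continuous_on (sphere 0 1 \<times> sphere 0 1)
        (\<lambda>z. (\<lambda>z. rho (\<mu> i) (fst z) (snd z)) ((fst z, 0), snd z))"
      by (rule continuous_on_compose2[OF rho_cont[OF that]])
         (auto intro!: continuous_intros simp: K_def hyperplanes_def norm_Pair)
    then show ?thesis
      unfolding Y_def soft_threshold_def by (auto intro!: continuous_intros)
  qed
  have "\<exists>u v. norm u = 1 \<and> norm v = 1 \<and> (\<forall>k<(d - 1) + d. f k u v = 0)"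
  proof (rule common_zero_of_biodd_maps)
    \<comment> \<open>Since \<open>d = 2 ^ t\<close>, the row is
      \<open>2 * d - 1 = 2 ^ Suc t - 1\<close>.\<close>
    show "odd ((d - 1 + d) choose (d - 1))"
      unfolding n using odd_binomial_two_power_minus_1[of "d - 1" "Suc t"] assms(1) by simp
    show "continuous_on (sphere 0 1 \<times> sphere 0 1) (\<lambda>z. f k (fst z) (snd z))" for k
      unfolding f_def by (cases "k < 2 * d - 2") (auto intro!: continuous_intros Y_cont)
    show "f k (- u) v = - f k u v" "f k u (- v) = - f k u v" for k u v
      unfolding f_def by (auto simp: Y_odd sum_negf)
  qed (use assms(2) \<open>d > 0\<close> in auto)
  then obtain u v where uv: "norm u = 1" "norm v = 1" "\<And>k. k < 2 * d - 1 \<Longrightarrow> f k u v = 0"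
    unfolding n by blast
  define y where "y i = Y i u v" for i
  have H: "((u, 0), v) \<in> K"
    using uv by (simp add: K_def hyperplanes_def norm_Pair)
  have "f (2 * d - 2) u v = 0"
    using \<open>d > 0\<close> by (intro uv(3)) auto
  then have sum0: "(\<Sum>i=1..m. y i) = 0"
    by (simp add: f_def y_def)
  define w where "w = (\<Sum>i=1..m. y i *\<^sub>R x i)"
  have "w \<in> V"
    unfolding w_def using assms(3,6) by (auto intro!: subspace_sum subspace_mul)
  have "orthogonal w e" if "e \<in> B" for e
  proof -
    obtain k where "k < 2 * d - 2" "e = b k"
      using b \<open>e \<in> B\<close> by (auto simp: bij_betw_def)
    then show ?thesis
      using uv(3)[of k] by (simp add: f_def orthogonal_def w_def y_def inner_sum_left)
  qed
  then have "orthogonal w w"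
    using orthogonal_to_span[of w B w] \<open>w \<in> V\<close> B(4) by blast
  then have lin0: "w = 0"
    by (simp add: orthogonal_def)
  obtain l where "l \<in> {1..m}" "\<bar>rho (\<mu> l) (u, 0) v\<bar> \<ge> c"
    using assms(9) H unfolding K_def by blast
  then have "rho (\<mu> l) (u, 0) v > a \<or> rho (\<mu> l) (u, 0) v < - a"
    using a(2) by linarith
  then have "y l \<noteq> 0"
    unfolding y_def Y_def neq_iff soft_threshold_pos_iff[OF a(1)] soft_threshold_neg_iff[OF a(1)] by blast
  with \<open>l \<in> {1..m}\<close> have "\<exists>i\<in>{1..m}. y i \<noteq> 0" ..
  define S where "S = {i\<in>{1..m}. y i > 0}"
  define T where "T = {i\<in>{1..m}. y i < 0}"
  have "convex hull (x ` S) \<inter> convex hull (x ` T) \<noteq> {}"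
    unfolding S_def T_def using lin0 sum0 \<open>\<exists>i\<in>{1..m}. y i \<noteq> 0\<close>
    by (intro affine_dependence_convex_hulls_meet) (auto simp: w_def)
  then have "(S, T) \<in> \<R>"
    by (auto simp: \<R>_def S_def T_def)
  then obtain i where i: "i \<in> S \<union> T" "r S i ((u, 0), v) < \<alpha> (S, T)"
    using \<alpha>(2)[OF _ H] by fastforce
  \<comment> \<open>The weights indexed by \<open>S\<close> and \<open>T\<close> survived the
    threshold \<open>a\<close>, which is at least \<open>\<alpha> (S, T)\<close>.\<close>
  moreover have "r S i ((u, 0), v) > a"
    using i(1) soft_threshold_pos_iff[OF a(1)] soft_threshold_neg_iff[OF a(1)]
    by (auto simp: S_def T_def r_def y_def Y_def)
  ultimately show False
    using a(3)[OF \<open>(S, T) \<in> \<R>\<close>] by simp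
qed

end
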